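(* Let $n$ be a positive integer. The sum of $l(\mu)+\frac{1-(-1)^{r(\mu)}}{2}$ over all partitions $\mu$ of $n$ into distinct parts equals the sum of $l(\lambda)-\frac{\lambda_1-1}{2}$ over all partitions $\lambda$ of $n$ into odd parts; namely, $$\sum_{\mu\in D_n}\left(l(\mu)+\frac{1-(-1)^{r(\mu)}}{2}\right)=\sum_{\lambda\in O_n}\left(l(\lambda)-\frac{\lambda_1-1}{2}\right).$$
   Context: A partition $\lambda$ of a positive integer $n$ is a finite nonincreasing sequence of positive integers $\lambda_1,\lambda_2,\ldots,\lambda_r$ with $\sum_i\lambda_i=n$; the $\lambda_i$ are its parts, $\lambda_1$ is its largest part, and $l(\lambda)=r$ is its number of parts (its length). The rank of $\lambda$ is $r(\lambda)=\lambda_1-l(\lambda)$. $D_n$ is the set of partitions of $n$ into distinct parts, and $O_n$ is the set of partitions of $n$ into odd parts (repetitions allowed). *)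

theory Defs
  imports Complex_Main
begin

definition partitions :: "nat \<Rightarrow> nat list set" where
  "partitions n = {xs. sorted_wrt (\<ge>) xs \<and> (\<forall>x\<in>set xs. x > 0) \<and> sum_list xs = n}"

text \<open>
  For a nonempty partition the head of the list is its largest part, since the parts are
  listed in nonincreasing order. The value on the empty list (the partition of 0) is unspecified.
\<close>
definition largest_part :: "nat list \<Rightarrow> nat" where
  "largest_part xs = hd xs"

definition rank :: "nat list \<Rightarrow> int" where
  "rank xs = int (largest_part xs) - int (length xs)"

definition distinct_partitions :: "nat \<Rightarrow> nat list set" where
  "distinct_partitions n = {xs \<in> partitions n. distinct xs}"

definition odd_partitions :: "nat \<Rightarrow> nat list set" where
  "odd_partitions n = {xs \<in> partitions n. \<forall>x\<in>set xs. odd x}"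

text \<open>Sums over an infinite index set are 0 by convention; the index sets used here are finite.\<close>
lemma finite_partitions: "finite (partitions n)"
proof (rule finite_subset)
  show "partitions n \<subseteq> {xs. set xs \<subseteq> {..n} \<and> length xs \<le> n}"
  proof
    fix xs assume xs: "xs \<in> partitions n"
    have "length ys \<le> sum_list ys" if "\<forall>y\<in>set ys. y > 0" for ys :: "nat list"
      using that by (induction ys) auto
    with xs show "xs \<in> {xs. set xs \<subseteq> {..n} \<and> length xs \<le> n}"
      by (auto simp: partitions_def member_le_sum_list)
  qed
  show "finite {xs. set xs \<subseteq> {..n} \<and> length xs \<le> n}"
    by (rule finite_lists_length_le) simp
qed

end

theory Submission
  imports Defs "HOL-Computational_Algebra.Polynomial"
begin

text \<open>
  Two refinements of Euler's theorem, both due to Fine, combine to give the identity.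

  The first concerns the rank: for every \<open>k\<close>, the partitions of \<open>n\<close> into odd parts with largest
  part \<open>2 * k + 1\<close> are equinumerous with the partitions of \<open>n\<close> into distinct parts of rank
  \<open>2 * k\<close> or \<open>2 * k + 1\<close>. An explicit bijection comes from Dyson's map: remove the first column of
  a partition with \<open>l\<close> parts and put a new row of length \<open>l + r\<close> on top. This adds \<open>r\<close> to the size
  and turns the distinct partitions of rank at most \<open>r\<close> into those of rank \<open>r - 1\<close> or \<open>r\<close>.
  Starting from the empty partition and applying the map for the parts \<open>r\<close> of an odd partition,
  the smallest first, produces a distinct partition of the same size (\<open>bij_betw_iterated_dyson\<close>).
  As \<open>r\<close> is odd, it is determined by the rank of the result, so the process can be undone.

  The second concerns the largest part: the partitions \<open>\<mu>\<close> of \<open>n\<close> into distinct parts with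
  \<open>\<mu>\<^sub>1 = k\<close> are equinumerous with the partitions \<open>\<nu>\<close> of \<open>n\<close> into odd parts with
  \<open>l(\<nu>) + (\<nu>\<^sub>1 - 1) / 2 = k\<close>. Both families have the size generating function
  \<open>q\<^sup>k (1 + q) (1 + q\<^sup>2) \<dots> (1 + q\<^bsup>k-1\<^esup>)\<close>, because both satisfy the recurrence
  \<open>F\<^bsub>k+1\<^esub> = (q + q\<^bsup>k+1\<^esup>) F\<^sub>k\<close> with \<open>F\<^sub>1 = q\<close> (\<open>size_poly_hook_rows_eq\<close>).

  Now let \<open>\<mu>\<close> correspond to \<open>\<nu>\<close> under the first bijection. The parity term
  \<open>(1 - (-1)\<^bsup>r(\<mu>)\<^esup>) / 2\<close> is the excess of \<open>r(\<mu>) = \<mu>\<^sub>1 - l(\<mu>)\<close> over \<open>\<nu>\<^sub>1 - 1\<close>, so the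
  summand on the distinct side equals \<open>\<mu>\<^sub>1 - (\<nu>\<^sub>1 - 1)\<close>. By the second result the \<open>\<mu>\<^sub>1\<close> add
  up to the sum of all \<open>l(\<nu>) + (\<nu>\<^sub>1 - 1) / 2\<close>, and subtracting \<open>\<nu>\<^sub>1 - 1\<close> from each term
  leaves \<open>l(\<nu>) - (\<nu>\<^sub>1 - 1) / 2\<close>. The equality holds only for the sums: the two results come from
  different correspondences.
\<close>

section \<open>Partitions into distinct parts\<close>

definition strict_partition :: "nat list \<Rightarrow> bool" where
  "strict_partition xs \<longleftrightarrow> sorted_wrt (>) xs \<and> (\<forall>x\<in>set xs. x > 0)"

lemma strict_partition_Nil [simp]: "strict_partition []"
  by (simp add: strict_partition_def)

lemma strict_partition_Cons:
  "strict_partition (x # xs) \<longleftrightarrow> x > 0 \<and> (\<forall>y\<in>set xs. y < x) \<and> strict_partition xs"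
  by (auto simp: strict_partition_def)

lemma sorted_wrt_greater_iff_distinct:
  fixes xs :: "nat list"
  shows "sorted_wrt (>) xs \<longleftrightarrow> sorted_wrt (\<ge>) xs \<and> distinct xs"
  by (induction xs) (auto simp: less_le)

lemma distinct_partitions_eq:
  "distinct_partitions n = {xs. strict_partition xs \<and> sum_list xs = n}"
  by (auto simp: distinct_partitions_def partitions_def strict_partition_def
      sorted_wrt_greater_iff_distinct)

text \<open>
  Equivalently, a nonempty distinct partition has nonnegative rank, which is what lets it
  lie in the range of Dyson's map for some odd \<open>r > 0\<close>.
\<close>
lemma strict_partition_length_le_hd:
  assumes "strict_partition xs" "xs \<noteq> []"
  shows "length xs \<le> hd xs"
  using assms
proof (induction xs)
  case (Cons x xs)
  then show ?case
    by (cases xs) (auto simp: strict_partition_Cons)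
qed simp

text \<open>
  Removing the first column from the diagram lowers every part by one and makes the part 1,
  which occurs at most once, disappear; \<open>e\<close> records whether it was there. In these coordinates
  Dyson's map needs no truncated subtraction.
\<close>
lemma strict_partition_remove_column:
  assumes "strict_partition xs"
  obtains ys e where "xs = map Suc ys @ replicate e 1" "e \<le> 1" "strict_partition ys"
  using assms
proof (induction xs arbitrary: thesis)
  case Nil
  show ?case by (rule Nil(1)[of "[]" 0]) auto
next
  case (Cons x xs)
  have "strict_partition xs" using Cons.prems(2) by (simp add: strict_partition_Cons)
  then obtain ys e where ys: "xs = map Suc ys @ replicate e 1" "e \<le> 1" "strict_partition ys"
    using Cons.IH by blast
  show ?case
  proof (cases "x = 1")
    case True
    then have "xs = []"
      using Cons.prems(2) by (cases xs) (auto simp: strict_partition_Cons)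
    then show ?thesis using True by (intro Cons.prems(1)[of "[]" 1]) auto
  next
    case False
    then show ?thesis
      using Cons.prems(2) ys by (intro Cons.prems(1)[of "(x - 1) # ys" e])
        (auto simp: strict_partition_Cons less_diff_conv)
  qed
qed

lemma strict_partition_add_column:
  assumes "strict_partition ys" "e \<le> 1"
  shows "strict_partition (map Suc ys @ replicate e 1)"
proof -
  have "e = 0 \<or> e = 1" using assms(2) by auto
  then show ?thesis
    using assms(1) by (auto simp: strict_partition_def sorted_wrt_append sorted_wrt_map)
qed

section \<open>Iterating Dyson's map\<close>

text \<open>
  Dyson's map, adjusted to distinct partitions: the filter discards the empty row that a part 1 leaves
  behind when the first column is removed.
\<close>
definition dyson :: "nat \<Rightarrow> nat list \<Rightarrow> nat list" where
  "dyson r xs = (length xs + r) # filter (\<lambda>x. x > 0) (map (\<lambda>x. x - 1) xs)"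

lemma dyson_add_column:
  assumes "strict_partition ys"
  shows "dyson r (map Suc ys @ replicate e 1) = (length ys + e + r) # ys"
proof -
  have "filter (\<lambda>x. x > 0) ys = ys"
    using assms by (auto simp: strict_partition_def filter_id_conv)
  then show ?thesis by (simp add: dyson_def comp_def)
qed

lemma rank_Cons: "rank (a # ys) = int a - int (length ys) - 1"
  by (simp add: rank_def largest_part_def)

text \<open>
  The bound on the head says that the rank is at most \<open>r\<close>; it is exactly what makes the new top row
  longer than the rows \<open>hd xs - 1 > \<dots>\<close> below it. The rank of the image is \<open>r - 1 + e\<close>, where \<open>e\<close>
  tells whether the part 1 occurred, since this part is lost when the column is removed.
\<close>
lemma dyson_props:
  assumes "strict_partition xs" "r > 0" "xs \<noteq> [] \<Longrightarrow> hd xs \<le> length xs + r"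
  shows "strict_partition (dyson r xs)" "sum_list (dyson r xs) = r + sum_list xs"
    "rank (dyson r xs) \<in> {int r - 1, int r}"
proof -
  obtain ys e where ys: "xs = map Suc ys @ replicate e 1" "e \<le> 1" "strict_partition ys"
    using strict_partition_remove_column[OF assms(1)] .
  have eq: "dyson r xs = (length ys + e + r) # ys"
    unfolding ys(1) by (rule dyson_add_column[OF ys(3)])
  have "y < length ys + e + r" if "y \<in> set ys" for y
  proof -
    obtain z zs where z: "ys = z # zs" using \<open>y \<in> set ys\<close> by (cases ys) auto
    have "y \<le> z" using that ys(3) z by (auto simp: strict_partition_Cons)
    moreover have "Suc z \<le> length ys + e + r" using assms(3) ys(1) z by simp
    ultimately show ?thesis by simp
  qed
  then show "strict_partition (dyson r xs)"
    using ys(3) assms(2) by (simp add: eq strict_partition_Cons)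
  have "sum_list (map Suc ys) = sum_list ys + length ys" by (induction ys) auto
  then show "sum_list (dyson r xs) = r + sum_list xs"
    unfolding eq by (simp add: ys(1) sum_list_replicate)
  show "rank (dyson r xs) \<in> {int r - 1, int r}"
    using ys(2) by (auto simp: eq rank_Cons le_Suc_eq)
qed

lemma dyson_inject:
  assumes "strict_partition xs" "strict_partition xs'" "dyson r xs = dyson r xs'"
  shows "xs = xs'"
proof -
  obtain ys e where ys: "xs = map Suc ys @ replicate e 1" "e \<le> 1" "strict_partition ys"
    using strict_partition_remove_column[OF assms(1)] .
  obtain ys' e' where ys': "xs' = map Suc ys' @ replicate e' 1" "e' \<le> 1" "strict_partition ys'"
    using strict_partition_remove_column[OF assms(2)] .
  have "(length ys + e + r) # ys = (length ys' + e' + r) # ys'"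
    using assms(3) unfolding ys(1) ys'(1) dyson_add_column[OF ys(3)] dyson_add_column[OF ys'(3)] .
  then have "ys = ys'" "e = e'" by auto
  then show ?thesis by (simp add: ys(1) ys'(1))
qed

text \<open>
  The rank of \<open>\<mu>\<close> tells whether a part 1 has to be restored: removing the top row and putting back a
  first column of length \<open>length ys + e\<close>, with \<open>e = rank \<mu> + 1 - r\<close>, undoes the map.
\<close>
lemma dyson_surj:
  assumes "strict_partition \<mu>" "\<mu> \<noteq> []" "rank \<mu> \<in> {int r - 1, int r}"
  obtains xs where "strict_partition xs" "dyson r xs = \<mu>" "xs \<noteq> [] \<Longrightarrow> hd xs \<le> length xs + r"
proof -
  obtain a ys where \<mu>: "\<mu> = a # ys" using assms(2) by (cases \<mu>) auto
  define e where "e = nat (rank \<mu> + 1 - int r)"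
  have e: "e \<le> 1" and a: "a = length ys + e + r"
    using assms(3) by (auto simp: e_def \<mu> rank_Cons)
  have ys: "strict_partition ys" "\<And>y. y \<in> set ys \<Longrightarrow> y < a"
    using assms(1) by (auto simp: \<mu> strict_partition_Cons)
  show ?thesis
  proof
    show "strict_partition (map Suc ys @ replicate e 1)"
      by (rule strict_partition_add_column[OF ys(1) e])
    show "dyson r (map Suc ys @ replicate e 1) = \<mu>"
      by (simp only: dyson_add_column[OF ys(1)] \<mu> a)
    show "hd (map Suc ys @ replicate e 1) \<le> length (map Suc ys @ replicate e 1) + r"
      if "map Suc ys @ replicate e 1 \<noteq> []"
      using that ys(2)[of "hd ys"] a e by (cases ys; cases e) auto
  qed
qed

definition odd_partition :: "nat list \<Rightarrow> bool" where
  "odd_partition xs \<longleftrightarrow> sorted_wrt (\<ge>) xs \<and> (\<forall>x\<in>set xs. odd x)"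

lemma odd_partition_Cons:
  "odd_partition (x # xs) \<longleftrightarrow> odd x \<and> (\<forall>y\<in>set xs. y \<le> x) \<and> odd_partition xs"
  by (auto simp: odd_partition_def)

lemma odd_partitions_eq: "odd_partitions n = {xs. odd_partition xs \<and> sum_list xs = n}"
proof -
  have "(\<forall>x\<in>set xs. 0 < x) \<and> (\<forall>x\<in>set xs. odd x) \<longleftrightarrow> (\<forall>x\<in>set xs. odd x)" for xs :: "nat list"
    using odd_pos by blast
  then show ?thesis
    unfolding odd_partitions_def partitions_def odd_partition_def by blast
qed

definition iterated_dyson :: "nat list \<Rightarrow> nat list" where
  "iterated_dyson xs = foldr dyson xs []"

lemma iterated_dyson_simps [simp]:
  "iterated_dyson [] = []"
  "iterated_dyson (r # xs) = dyson r (iterated_dyson xs)"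
  by (simp_all add: iterated_dyson_def)

lemma iterated_dyson_Nil_iff: "iterated_dyson xs = [] \<longleftrightarrow> xs = []"
  by (cases xs) (auto simp: dyson_def)

lemma hd_le_if_rank_le:
  assumes "xs \<noteq> []" "rank xs \<le> int r"
  shows "hd xs \<le> length xs + r"
  using assms by (simp add: rank_def largest_part_def)

text \<open>
  The parts of an odd partition weakly increase from right to left, so the rank reached with one part,
  which is at most that part, satisfies the bound required by Dyson's map for the next one.
\<close>
lemma iterated_dyson_props:
  assumes "odd_partition xs"
  shows "strict_partition (iterated_dyson xs) \<and> sum_list (iterated_dyson xs) = sum_list xs \<and>
    (xs \<noteq> [] \<longrightarrow> rank (iterated_dyson xs) \<in> {int (hd xs) - 1, int (hd xs)})"
  using assms
proof (induction xs)
  case (Cons r xs)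
  let ?\<mu> = "iterated_dyson xs"
  have IH: "strict_partition ?\<mu>" "sum_list ?\<mu> = sum_list xs"
    "xs \<noteq> [] \<Longrightarrow> rank ?\<mu> \<in> {int (hd xs) - 1, int (hd xs)}"
    using Cons by (auto simp: odd_partition_Cons)
  have r: "r > 0" using Cons.prems by (auto simp: odd_partition_Cons odd_pos)
  have bound: "hd ?\<mu> \<le> length ?\<mu> + r" if "?\<mu> \<noteq> []"
  proof (rule hd_le_if_rank_le[OF that])
    have "xs \<noteq> []" using that by auto
    then have "rank ?\<mu> \<le> int (hd xs)" "hd xs \<le> r"
      using IH(3) Cons.prems by (auto simp: odd_partition_Cons)
    then show "rank ?\<mu> \<le> int r" by simp
  qed
  show ?case using dyson_props[OF IH(1) r bound] IH(2) by simp
qed simp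

text \<open>
  The last \<open>r\<close> used is the odd one among \<open>rank\<close> and \<open>rank + 1\<close> of the image; it can be read off and
  the last step undone.
\<close>
lemma iterated_dyson_inject:
  assumes "odd_partition xs" "odd_partition ys" "iterated_dyson xs = iterated_dyson ys"
  shows "xs = ys"
  using assms
proof (induction xs arbitrary: ys)
  case Nil
  then show ?case by (metis iterated_dyson_Nil_iff)
next
  case (Cons r xs)
  then obtain s zs where ys: "ys = s # zs"
    by (metis iterated_dyson_Nil_iff list.exhaust list.distinct(1))
  have "int r \<in> {int s - 1, int s, int s + 1}"
    using iterated_dyson_props[OF Cons.prems(1)] iterated_dyson_props[OF Cons.prems(2)] Cons.prems(3)
    by (auto simp: ys)
  moreover have "odd r" "odd s" using Cons.prems by (auto simp: ys odd_partition_Cons)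
  ultimately have "r = s" by (auto, presburger+)
  have odd: "odd_partition xs" "odd_partition zs"
    using Cons.prems by (auto simp: ys odd_partition_Cons)
  then have "iterated_dyson xs = iterated_dyson zs"
    using dyson_inject iterated_dyson_props Cons.prems(3) unfolding ys \<open>r = s\<close> by simp
  then show ?case using Cons.IH odd by (simp add: ys \<open>r = s\<close>)
qed

text \<open>
  Undoing Dyson's map for the odd number \<open>r\<close> among \<open>rank \<mu>\<close> and \<open>rank \<mu> + 1\<close> gives a smaller
  distinct partition. Its rank is at most \<open>r\<close>, so the odd parts found for it recursively do not
  exceed \<open>r\<close>: the largest of them is at most \<open>r + 1\<close>, hence at most \<open>r\<close> by parity.
\<close>
lemma iterated_dyson_surj:
  assumes "strict_partition \<mu>"
  shows "\<exists>xs. odd_partition xs \<and> iterated_dyson xs = \<mu>"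
  using assms
proof (induction "sum_list \<mu>" arbitrary: \<mu> rule: less_induct)
  case less
  show ?case
  proof (cases "\<mu> = []")
    case True
    then show ?thesis by (intro exI[of _ "[]"]) (simp add: odd_partition_def)
  next
    case False
    have "rank \<mu> \<ge> 0"
      using strict_partition_length_le_hd[OF less.prems False]
      by (simp add: rank_def largest_part_def)
    \<comment> \<open>the odd one among \<open>rank \<mu>\<close> and \<open>rank \<mu> + 1\<close>\<close>
    define r where "r = 2 * nat (rank \<mu> div 2) + 1"
    have r: "odd r" "r > 0" "rank \<mu> \<in> {int r - 1, int r}"
      using \<open>rank \<mu> \<ge> 0\<close> by (simp_all add: r_def, presburger)
    obtain \<nu> where \<nu>: "strict_partition \<nu>" "dyson r \<nu> = \<mu>" "\<nu> \<noteq> [] \<Longrightarrow> hd \<nu> \<le> length \<nu> + r"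
      using dyson_surj[OF less.prems False r(3)] by metis
    have "sum_list \<nu> < sum_list \<mu>"
      using dyson_props(2)[OF \<nu>(1) r(2) \<nu>(3)] r(2) \<nu>(2) by simp
    then obtain xs where xs: "odd_partition xs" "iterated_dyson xs = \<nu>"
      using less.hyps \<nu>(1) by blast
    have "y \<le> r" if "y \<in> set xs" for y
    proof -
      have "xs \<noteq> []" "\<nu> \<noteq> []" using that xs(2) by (auto simp: iterated_dyson_Nil_iff)
      then have "rank \<nu> \<le> int r"
        using \<nu>(3) by (simp add: rank_def largest_part_def)
      moreover have "rank \<nu> \<ge> int (hd xs) - 1"
        using iterated_dyson_props[OF xs(1)] \<open>xs \<noteq> []\<close> by (auto simp: xs(2))
      moreover have "odd (hd xs)" using xs(1) \<open>xs \<noteq> []\<close> by (simp add: odd_partition_def)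
      ultimately have "hd xs \<le> r" using r(1) by presburger
      moreover have "y \<le> hd xs" using that xs(1) by (cases xs) (auto simp: odd_partition_Cons)
      ultimately show ?thesis by simp
    qed
    then have "odd_partition (r # xs)" using r(1) xs(1) by (simp add: odd_partition_Cons)
    moreover have "iterated_dyson (r # xs) = \<mu>" by (simp add: xs(2) \<nu>(2))
    ultimately show ?thesis by blast
  qed
qed

lemma bij_betw_iterated_dyson:
  "bij_betw iterated_dyson (odd_partitions n) (distinct_partitions n)"
  unfolding bij_betw_def
proof
  show "inj_on iterated_dyson (odd_partitions n)"
    by (auto simp: inj_on_def odd_partitions_eq iterated_dyson_inject)
  show "iterated_dyson ` odd_partitions n = distinct_partitions n"
  proof
    show "iterated_dyson ` odd_partitions n \<subseteq> distinct_partitions n"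
      using iterated_dyson_props by (auto simp: odd_partitions_eq distinct_partitions_eq)
    show "distinct_partitions n \<subseteq> iterated_dyson ` odd_partitions n"
    proof
      fix \<mu> assume "\<mu> \<in> distinct_partitions n"
      then have \<mu>: "strict_partition \<mu>" "sum_list \<mu> = n" by (auto simp: distinct_partitions_eq)
      then obtain xs where xs: "odd_partition xs" "iterated_dyson xs = \<mu>"
        using iterated_dyson_surj by blast
      then have "xs \<in> odd_partitions n"
        using iterated_dyson_props[OF xs(1)] \<mu>(2) by (simp add: odd_partitions_eq)
      then show "\<mu> \<in> iterated_dyson ` odd_partitions n" using xs(2) by blast
    qed
  qed
qed

section \<open>Size generating functions\<close>

definition size_poly :: "('a \<Rightarrow> nat) \<Rightarrow> 'a set \<Rightarrow> nat poly" where
  "size_poly w A = (\<Sum>a\<in>A. monom 1 (w a))"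

lemma coeff_size_poly:
  assumes "finite A"
  shows "coeff (size_poly w A) n = card {a \<in> A. w a = n}"
  using assms by (simp add: size_poly_def coeff_sum sum.If_cases Int_def)

lemma size_poly_Un:
  assumes "finite A" "finite B" "A \<inter> B = {}"
  shows "size_poly w (A \<union> B) = size_poly w A + size_poly w B"
  using assms by (simp add: size_poly_def sum.union_disjoint)

lemma size_poly_image:
  assumes "inj_on f A" "\<And>a. a \<in> A \<Longrightarrow> w (f a) = c + w a"
  shows "size_poly w (f ` A) = monom 1 c * size_poly w A"
  using assms by (simp add: size_poly_def sum.reindex sum_distrib_left mult_monom)

lemma size_poly_empty [simp]: "size_poly w {} = 0"
  by (simp add: size_poly_def)

lemma size_poly_singleton [simp]: "size_poly w {a} = monom 1 (w a)"
  by (simp add: size_poly_def)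

section \<open>Distinct partitions by largest part\<close>

text \<open>
  The generating function of this set is \<open>(1 + q) \<dots> (1 + q\<^bsup>k-1\<^esup>)\<close>, the part \<open>i < k\<close> being present
  or absent.
\<close>
definition strict_below :: "nat \<Rightarrow> nat list set" where
  "strict_below k = {xs. strict_partition xs \<and> (\<forall>x\<in>set xs. x < k)}"

lemma strict_below_Suc:
  assumes "k > 0"
  shows "strict_below (Suc k) = strict_below k \<union> Cons k ` strict_below k"
proof (intro equalityI subsetI)
  fix xs assume "xs \<in> strict_below (Suc k)"
  then show "xs \<in> strict_below k \<union> Cons k ` strict_below k"
    by (cases xs) (fastforce simp: strict_below_def strict_partition_Cons less_Suc_eq)+
next
  fix xs assume "xs \<in> strict_below k \<union> Cons k ` strict_below k"
  then show "xs \<in> strict_below (Suc k)"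
    using assms by (auto simp: strict_below_def strict_partition_Cons less_Suc_eq)
qed

lemma strict_below_1: "strict_below (Suc 0) = {[]}"
proof -
  have "xs = []" if "xs \<in> strict_below (Suc 0)" for xs
    using that by (cases xs) (auto simp: strict_below_def strict_partition_Cons)
  then show ?thesis by (auto simp: strict_below_def)
qed

lemma finite_strict_below: "finite (strict_below (Suc k))"
  by (induction k) (simp_all add: strict_below_1 strict_below_Suc)

definition strict_with_largest :: "nat \<Rightarrow> nat list set" where
  "strict_with_largest k = {xs. strict_partition xs \<and> xs \<noteq> [] \<and> hd xs = k}"

lemma strict_with_largest_eq:
  assumes "k > 0"
  shows "strict_with_largest k = Cons k ` strict_below k"
proof (intro equalityI subsetI)
  fix xs assume "xs \<in> strict_with_largest k"
  then show "xs \<in> Cons k ` strict_below k"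
    by (cases xs) (auto simp: strict_with_largest_def strict_below_def strict_partition_Cons)
next
  fix xs assume "xs \<in> Cons k ` strict_below k"
  then show "xs \<in> strict_with_largest k"
    using assms by (auto simp: strict_with_largest_def strict_below_def strict_partition_Cons)
qed

lemma strict_with_largest_0: "strict_with_largest 0 = {}"
proof -
  have "xs = []" if "strict_partition xs" "hd xs = 0" for xs
    using that by (cases xs) (auto simp: strict_partition_Cons)
  then show ?thesis by (auto simp: strict_with_largest_def)
qed

lemma finite_strict_with_largest: "finite (strict_with_largest k)"
  using finite_strict_below[of "k - 1"]
  by (cases k) (simp_all add: strict_with_largest_0 strict_with_largest_eq)

lemma size_poly_strict_with_largest:
  assumes "k > 0"
  shows "size_poly sum_list (strict_with_largest k) =
    monom 1 k * size_poly sum_list (strict_below k)"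
  unfolding strict_with_largest_eq[OF assms] by (rule size_poly_image) auto

lemma size_poly_strict_with_largest_1:
  "size_poly sum_list (strict_with_largest (Suc 0)) = monom 1 1"
  by (simp add: size_poly_strict_with_largest strict_below_1 mult_monom)

text \<open>
  If \<open>k\<close> is not a part, lowering the largest part \<open>k + 1\<close> to \<open>k\<close> loses one unit; if \<open>k\<close> is a part,
  dropping \<open>k + 1\<close> loses \<open>k + 1\<close> units. The proof obtains the same recurrence from the product
  form.
\<close>
lemma size_poly_strict_with_largest_Suc:
  assumes "k > 0"
  shows "size_poly sum_list (strict_with_largest (Suc k)) =
    (monom 1 1 + monom 1 (Suc k)) * size_poly sum_list (strict_with_largest k)"
proof -
  have fin: "finite (strict_below k)"
    using finite_strict_below[of "k - 1"] assms by simp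
  have "size_poly sum_list (strict_below (Suc k)) =
    size_poly sum_list (strict_below k) + size_poly sum_list (Cons k ` strict_below k)"
    unfolding strict_below_Suc[OF assms] using fin
    by (intro size_poly_Un) (auto simp: strict_below_def)
  also have "size_poly sum_list (Cons k ` strict_below k) =
    monom 1 k * size_poly sum_list (strict_below k)"
    by (rule size_poly_image) auto
  finally have *: "size_poly sum_list (strict_below (Suc k)) =
    (1 + monom 1 k) * size_poly sum_list (strict_below k)"
    by (simp add: algebra_simps)
  have "monom 1 (Suc k) * (1 + monom 1 k) = (monom 1 1 + monom 1 (Suc k)) * (monom 1 k :: nat poly)"
    by (simp add: algebra_simps mult_monom)
  then show ?thesis
    using assms by (simp only: size_poly_strict_with_largest * mult.assoc[symmetric] zero_less_Suc)
qed

section \<open>Odd partitions by hook length\<close>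

text \<open>
  The partition with odd parts \<open>2 * x + 1\<close> is represented by the rows \<open>x\<close> (its diagram with cells of
  weight 2 and a first column of weight 1). Rows may be 0, which stands for a part 1, and the quantity
  \<open>l(\<nu>) + (\<nu>\<^sub>1 - 1) / 2\<close> becomes the number of rows plus the longest row, the hook length at the
  corner of that diagram.
\<close>
definition hook_rows :: "nat \<Rightarrow> nat list set" where
  "hook_rows k = {xs. sorted_wrt (\<ge>) xs \<and> xs \<noteq> [] \<and> length xs + hd xs = k}"

definition pos_hook_rows :: "nat \<Rightarrow> nat list set" where
  "pos_hook_rows k = {xs \<in> hook_rows k. 0 \<notin> set xs}"

definition odd_size :: "nat list \<Rightarrow> nat" where
  "odd_size xs = 2 * sum_list xs + length xs"

lemma finite_hook_rows: "finite (hook_rows k)"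
proof (rule finite_subset)
  show "hook_rows k \<subseteq> {xs. set xs \<subseteq> {..k} \<and> length xs \<le> k}"
  proof
    fix xs assume "xs \<in> hook_rows k"
    then show "xs \<in> {xs. set xs \<subseteq> {..k} \<and> length xs \<le> k}"
      by (cases xs) (auto simp: hook_rows_def)
  qed
qed (simp add: finite_lists_length_le)

lemma finite_pos_hook_rows: "finite (pos_hook_rows k)"
  by (simp add: pos_hook_rows_def finite_hook_rows)

lemma hook_rows_0: "hook_rows 0 = {}"
  by (auto simp: hook_rows_def)

lemma hook_rows_1: "hook_rows (Suc 0) = {[0]}"
proof -
  have "xs = [0]" if "xs \<in> hook_rows (Suc 0)" for xs
    using that by (cases xs) (auto simp: hook_rows_def)
  then show ?thesis by (auto simp: hook_rows_def)
qed

lemma pos_hook_rows_2: "pos_hook_rows (Suc (Suc 0)) = {[1]}"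
proof -
  have "xs = [1]" if xs: "xs \<in> pos_hook_rows (Suc (Suc 0))" for xs
  proof (cases xs)
    case (Cons a ys)
    then show ?thesis using xs by (cases ys) (auto simp: hook_rows_def pos_hook_rows_def)
  qed (use xs in \<open>simp add: pos_hook_rows_def hook_rows_def\<close>)
  then show ?thesis by (auto simp: hook_rows_def pos_hook_rows_def)
qed

text \<open>
  An odd partition either has no part 1 or arises by appending one, which lengthens the hook by 1.
\<close>
lemma hook_rows_Suc:
  assumes "k > 0"
  shows "hook_rows (Suc k) = pos_hook_rows (Suc k) \<union> (\<lambda>xs. xs @ [0]) ` hook_rows k"
proof (intro equalityI subsetI)
  fix xs assume xs: "xs \<in> hook_rows (Suc k)"
  show "xs \<in> pos_hook_rows (Suc k) \<union> (\<lambda>xs. xs @ [0]) ` hook_rows k"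
  proof (cases "0 \<in> set xs")
    case True
    obtain ys a where ya: "xs = ys @ [a]" using True by (cases xs rule: rev_cases) auto
    then have "a = 0" using xs True by (auto simp: hook_rows_def sorted_wrt_append)
    have "ys \<noteq> []" using xs assms by (auto simp: ya \<open>a = 0\<close> hook_rows_def)
    then have "ys \<in> hook_rows k"
      using xs by (auto simp: ya hook_rows_def sorted_wrt_append)
    then show ?thesis by (auto simp: ya \<open>a = 0\<close>)
  qed (use xs in \<open>simp add: pos_hook_rows_def\<close>)
next
  fix xs assume "xs \<in> pos_hook_rows (Suc k) \<union> (\<lambda>xs. xs @ [0]) ` hook_rows k"
  then show "xs \<in> hook_rows (Suc k)"
    by (auto simp: hook_rows_def pos_hook_rows_def sorted_wrt_append)
qed

text \<open>
  In terms of the odd partition: raise the largest part by 2.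
\<close>
definition widen_top :: "nat list \<Rightarrow> nat list" where
  "widen_top xs = Suc (hd xs) # tl xs"

text \<open>
  In terms of the odd partition: raise all parts by 2 and then duplicate the largest one. The diagram
  gains a full row and a full column, so the hook grows by 2 and the size by \<open>2 * k + 3\<close> when the old
  hook is \<open>k\<close>.
\<close>
definition add_hook :: "nat list \<Rightarrow> nat list" where
  "add_hook xs = Suc (hd xs) # map Suc xs"

lemma widen_top_mem:
  assumes "xs \<in> pos_hook_rows (Suc k)"
  shows "widen_top xs \<in> pos_hook_rows (Suc (Suc k))"
  using assms by (cases xs) (auto simp: pos_hook_rows_def hook_rows_def widen_top_def)

lemma add_hook_mem:
  assumes "xs \<in> hook_rows k"
  shows "add_hook xs \<in> pos_hook_rows (Suc (Suc k))"
  using assms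
  by (cases xs) (auto simp: pos_hook_rows_def hook_rows_def add_hook_def sorted_wrt_map)

text \<open>
  Among odd partitions without a part 1, those whose largest part occurs twice are the images under
  \<open>add_hook\<close>, and those whose largest part occurs once are the images under \<open>widen_top\<close>. For \<open>k = 0\<close> this
  fails at the single part 3, which would come from the single part 1.
\<close>
lemma pos_hook_rows_Suc_Suc:
  assumes "k > 0"
  shows "pos_hook_rows (Suc (Suc k)) =
    widen_top ` pos_hook_rows (Suc k) \<union> add_hook ` hook_rows k"
proof (intro equalityI subsetI)
  fix xs assume xs: "xs \<in> pos_hook_rows (Suc (Suc k))"
  then obtain a ys where a: "xs = Suc a # ys"
    by (cases xs; cases "hd xs") (auto simp: pos_hook_rows_def hook_rows_def)
  show "xs \<in> widen_top ` pos_hook_rows (Suc k) \<union> add_hook ` hook_rows k"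
  proof (cases "ys \<noteq> [] \<and> hd ys = Suc a")
    case True
    define zs where "zs = map (\<lambda>y. y - 1) ys"
    have "0 \<notin> set ys" using xs by (auto simp: a pos_hook_rows_def)
    then have ys: "ys = map Suc zs"
      unfolding zs_def map_map by (intro map_idI[symmetric]) (metis comp_apply Suc_pred' gr0I)
    have "zs \<noteq> []" "hd zs = a" using True by (auto simp: ys hd_map)
    then have "zs \<in> hook_rows k" "xs = add_hook zs"
      using xs
      by (auto simp: a ys pos_hook_rows_def hook_rows_def add_hook_def sorted_wrt_map)
    then show ?thesis by blast
  next
    case False
    have "a # ys \<in> pos_hook_rows (Suc k)"
    proof (cases ys)
      case Nil
      then show ?thesis using xs assms by (auto simp: a pos_hook_rows_def hook_rows_def)
    next
      case (Cons b zs)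
      then show ?thesis using xs False by (fastforce simp: a pos_hook_rows_def hook_rows_def)
    qed
    moreover have "xs = widen_top (a # ys)" by (simp add: a widen_top_def)
    ultimately show ?thesis by blast
  qed
next
  fix xs assume "xs \<in> widen_top ` pos_hook_rows (Suc k) \<union> add_hook ` hook_rows k"
  then show "xs \<in> pos_hook_rows (Suc (Suc k))"
    using widen_top_mem add_hook_mem by blast
qed

lemma size_poly_hook_rows_Suc:
  assumes "k > 0"
  shows "size_poly odd_size (hook_rows (Suc k)) =
    size_poly odd_size (pos_hook_rows (Suc k)) + monom 1 1 * size_poly odd_size (hook_rows k)"
proof -
  have "size_poly odd_size ((\<lambda>xs. xs @ [0]) ` hook_rows k) =
      monom 1 1 * size_poly odd_size (hook_rows k)"
    by (rule size_poly_image) (auto simp: inj_on_def odd_size_def)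
  moreover have "size_poly odd_size (hook_rows (Suc k)) =
    size_poly odd_size (pos_hook_rows (Suc k)) +
    size_poly odd_size ((\<lambda>xs. xs @ [0]) ` hook_rows k)"
    unfolding hook_rows_Suc[OF assms]
    by (intro size_poly_Un) (auto simp: finite_hook_rows finite_pos_hook_rows pos_hook_rows_def)
  ultimately show ?thesis by simp
qed

lemma size_poly_pos_hook_rows_Suc_Suc:
  assumes "k > 0"
  shows "size_poly odd_size (pos_hook_rows (Suc (Suc k))) =
    monom 1 2 * size_poly odd_size (pos_hook_rows (Suc k)) +
    monom 1 (2 * k + 3) * size_poly odd_size (hook_rows k)"
proof -
  have "size_poly odd_size (widen_top ` pos_hook_rows (Suc k)) =
      monom 1 2 * size_poly odd_size (pos_hook_rows (Suc k))"
  proof (rule size_poly_image)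
    show "inj_on widen_top (pos_hook_rows (Suc k))"
      by (auto simp: inj_on_def widen_top_def pos_hook_rows_def hook_rows_def list.expand)
    show "odd_size (widen_top xs) = 2 + odd_size xs" if "xs \<in> pos_hook_rows (Suc k)" for xs
      using that by (cases xs) (auto simp: odd_size_def widen_top_def pos_hook_rows_def hook_rows_def)
  qed
  moreover have "size_poly odd_size (add_hook ` hook_rows k) =
      monom 1 (2 * k + 3) * size_poly odd_size (hook_rows k)"
  proof (rule size_poly_image)
    show "inj_on add_hook (hook_rows k)"
      by (auto simp: inj_on_def add_hook_def)
    have "sum_list (map Suc xs) = sum_list xs + length xs" for xs by (induction xs) auto
    then show "odd_size (add_hook xs) = 2 * k + 3 + odd_size xs" if "xs \<in> hook_rows k" for xs
      using that by (auto simp: odd_size_def add_hook_def hook_rows_def)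
  qed
  moreover have "widen_top xs \<noteq> add_hook ys"
    if "xs \<in> pos_hook_rows (Suc k)" "ys \<in> hook_rows k" for xs ys
    using that
    by (cases xs; cases ys) (auto simp: widen_top_def add_hook_def pos_hook_rows_def hook_rows_def)
  then have "size_poly odd_size (pos_hook_rows (Suc (Suc k))) =
    size_poly odd_size (widen_top ` pos_hook_rows (Suc k)) +
    size_poly odd_size (add_hook ` hook_rows k)"
    unfolding pos_hook_rows_Suc_Suc[OF assms]
    by (intro size_poly_Un) (auto simp: finite_hook_rows finite_pos_hook_rows)
  ultimately show ?thesis by simp
qed

text \<open>
  This is where the factor \<open>1 + q\<^sup>k\<close> of the recurrence comes from. Write \<open>F\<^sub>k\<close> for the
  generating function of all odd partitions with hook \<open>k\<close> and \<open>N\<^sub>k\<close> for that of the ones without a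
  part 1. Then \<open>N\<^bsub>k+2\<^esub> = q\<^sup>2 N\<^bsub>k+1\<^esub> + q\<^bsup>2k+3\<^esup> F\<^sub>k\<close>, and if
  \<open>N\<^bsub>k+1\<^esub> = q\<^bsup>k+1\<^esup> F\<^sub>k\<close>, the right side is \<open>q\<^bsup>k+2\<^esup> (q F\<^sub>k + N\<^bsub>k+1\<^esub>)\<close>, that
  is \<open>q\<^bsup>k+2\<^esup> F\<^bsub>k+1\<^esub>\<close>.
\<close>
lemma size_poly_pos_hook_rows:
  "size_poly odd_size (pos_hook_rows (Suc (Suc k))) =
    monom 1 (Suc (Suc k)) * size_poly odd_size (hook_rows (Suc k))"
proof (induction k)
  case 0
  show ?case by (simp add: pos_hook_rows_2 hook_rows_1 odd_size_def mult_monom eval_nat_numeral)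
next
  case (Suc k)
  let ?F = "size_poly odd_size (hook_rows (Suc k))"
  have "size_poly odd_size (pos_hook_rows (Suc (Suc (Suc k)))) =
    monom 1 2 * (monom 1 (Suc (Suc k)) * ?F) + monom 1 (2 * Suc k + 3) * ?F"
    by (simp only: size_poly_pos_hook_rows_Suc_Suc[OF zero_less_Suc] Suc.IH)
  also have "\<dots> = monom 1 (Suc (Suc (Suc k))) * (monom 1 (Suc (Suc k)) * ?F + monom 1 1 * ?F)"
    by (simp add: distrib_left mult.assoc[symmetric] mult_monom add.commute eval_nat_numeral)
  also have "\<dots> = monom 1 (Suc (Suc (Suc k))) * size_poly odd_size (hook_rows (Suc (Suc k)))"
    by (simp only: size_poly_hook_rows_Suc[OF zero_less_Suc, of k] Suc.IH)
  finally show ?case .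
qed

text \<open>
  With \<open>N\<^bsub>k+1\<^esub> = q\<^bsup>k+1\<^esup> F\<^sub>k\<close> the splitting \<open>F\<^bsub>k+1\<^esub> = N\<^bsub>k+1\<^esub> + q F\<^sub>k\<close> becomes the recurrence
  of the distinct partitions with largest part \<open>k\<close>, and the initial values agree.
\<close>
lemma size_poly_hook_rows_eq:
  "size_poly odd_size (hook_rows k) = size_poly sum_list (strict_with_largest k)"
proof (cases k)
  case 0
  then show ?thesis by (simp add: hook_rows_0 strict_with_largest_0)
next
  case (Suc j)
  have "size_poly odd_size (hook_rows (Suc j)) = size_poly sum_list (strict_with_largest (Suc j))"
  proof (induction j)
    case 0
    show ?case
      by (simp add: hook_rows_1 size_poly_strict_with_largest_1 odd_size_def)
  next
    case (Suc j)
    show ?case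
      unfolding size_poly_strict_with_largest_Suc[OF zero_less_Suc]
        size_poly_hook_rows_Suc[OF zero_less_Suc] size_poly_pos_hook_rows Suc.IH
      by (simp add: algebra_simps)
  qed
  then show ?thesis by (simp add: Suc)
qed

section \<open>The two sides compared\<close>

lemma sum_eq_if_same_level_sizes:
  fixes f :: "'a \<Rightarrow> nat" and g :: "'b \<Rightarrow> nat"
  assumes "finite A" "finite B" "\<And>k. card {a \<in> A. f a = k} = card {b \<in> B. g b = k}"
  shows "sum f A = sum g B"
proof -
  let ?T = "f ` A \<union> g ` B"
  have "sum f A = (\<Sum>k\<in>?T. \<Sum>a | a \<in> A \<and> f a = k. f a)"
    using assms(1,2) by (intro sum.group[symmetric]) auto
  also have "\<dots> = (\<Sum>k\<in>?T. k * card {a \<in> A. f a = k})"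
    by (intro sum.cong) auto
  also have "\<dots> = (\<Sum>k\<in>?T. k * card {b \<in> B. g b = k})"
    by (simp only: assms(3))
  also have "\<dots> = (\<Sum>k\<in>?T. \<Sum>b | b \<in> B \<and> g b = k. g b)"
    by (intro sum.cong) auto
  also have "\<dots> = sum g B"
    using assms(1,2) by (intro sum.group) auto
  finally show ?thesis .
qed

lemma card_odd_partitions_hook:
  assumes "n > 0"
  shows "card {\<nu> \<in> odd_partitions n. length \<nu> + hd \<nu> div 2 = k} =
    card {xs \<in> hook_rows k. odd_size xs = n}"
proof (rule bij_betw_same_card[symmetric])
  let ?odd = "map (\<lambda>x. 2 * x + 1) :: nat list \<Rightarrow> nat list"
  let ?half = "map (\<lambda>x. x div 2) :: nat list \<Rightarrow> nat list"
  have size: "sum_list (?odd xs) = odd_size xs" for xs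
    by (induction xs) (auto simp: odd_size_def)
  have odd_half: "?odd (?half \<nu>) = \<nu>" if "\<nu> \<in> odd_partitions n" for \<nu>
  proof -
    have "odd x" if "x \<in> set \<nu>" for x
      using \<open>\<nu> \<in> odd_partitions n\<close> that by (simp add: odd_partitions_eq odd_partition_def)
    then show ?thesis
      unfolding map_map comp_def by (intro map_idI odd_two_times_div_two_succ)
  qed
  have nonempty: "\<nu> \<noteq> []" if "\<nu> \<in> odd_partitions n" for \<nu>
    using that assms by (auto simp: odd_partitions_eq)
  show "bij_betw ?odd {xs \<in> hook_rows k. odd_size xs = n}
    {\<nu> \<in> odd_partitions n. length \<nu> + hd \<nu> div 2 = k}"
  proof (rule bij_betw_byWitness[where f' = ?half])
    show "\<forall>xs\<in>{xs \<in> hook_rows k. odd_size xs = n}. ?half (?odd xs) = xs"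
      by (simp add: comp_def)
    show "\<forall>\<nu>\<in>{\<nu> \<in> odd_partitions n. length \<nu> + hd \<nu> div 2 = k}. ?odd (?half \<nu>) = \<nu>"
      using odd_half by blast
    show "?odd ` {xs \<in> hook_rows k. odd_size xs = n}
      \<subseteq> {\<nu> \<in> odd_partitions n. length \<nu> + hd \<nu> div 2 = k}"
      using size
      by (auto simp: odd_partitions_eq odd_partition_def hook_rows_def sorted_wrt_map hd_map)
    show "?half ` {\<nu> \<in> odd_partitions n. length \<nu> + hd \<nu> div 2 = k}
      \<subseteq> {xs \<in> hook_rows k. odd_size xs = n}"
    proof
      fix xs assume "xs \<in> ?half ` {\<nu> \<in> odd_partitions n. length \<nu> + hd \<nu> div 2 = k}"
      then obtain \<nu> where \<nu>: "\<nu> \<in> odd_partitions n" "length \<nu> + hd \<nu> div 2 = k" "xs = ?half \<nu>"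
        by blast
      have "sorted_wrt (\<ge>) \<nu>"
        using \<nu>(1) by (simp add: odd_partitions_eq odd_partition_def)
      then have "sorted_wrt (\<ge>) xs"
        unfolding \<nu>(3) sorted_wrt_map by (rule sorted_wrt_mono_rel[rotated]) (rule div_le_mono)
      moreover have "odd_size xs = n"
        using size[of xs] odd_half[OF \<nu>(1)] \<nu>(1) by (simp add: \<nu>(3) odd_partitions_eq)
      ultimately show "xs \<in> {xs \<in> hook_rows k. odd_size xs = n}"
        using \<nu>(2) nonempty[OF \<nu>(1)] by (simp add: \<nu>(3) hook_rows_def hd_map)
    qed
  qed
qed

lemma finite_odd_partitions: "finite (odd_partitions n)"
  by (rule finite_subset[OF _ finite_partitions[of n]]) (auto simp: odd_partitions_def)

lemma finite_distinct_partitions: "finite (distinct_partitions n)"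
  by (rule finite_subset[OF _ finite_partitions[of n]]) (auto simp: distinct_partitions_def)

lemma sum_largest_part_eq_sum_hook:
  assumes "n > 0"
  shows "(\<Sum>\<mu>\<in>distinct_partitions n. hd \<mu>) = (\<Sum>\<nu>\<in>odd_partitions n. length \<nu> + hd \<nu> div 2)"
proof (rule sum_eq_if_same_level_sizes[OF finite_distinct_partitions finite_odd_partitions])
  fix k
  have "{\<mu> \<in> distinct_partitions n. hd \<mu> = k} = {\<mu> \<in> strict_with_largest k. sum_list \<mu> = n}"
    using assms by (auto simp: distinct_partitions_eq strict_with_largest_def)
  then have "card {\<mu> \<in> distinct_partitions n. hd \<mu> = k} =
      coeff (size_poly sum_list (strict_with_largest k)) n"
    by (simp add: coeff_size_poly finite_strict_with_largest)
  also have "\<dots> = card {xs \<in> hook_rows k. odd_size xs = n}"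
    by (simp add: size_poly_hook_rows_eq[symmetric] coeff_size_poly finite_hook_rows)
  also have "\<dots> = card {\<nu> \<in> odd_partitions n. length \<nu> + hd \<nu> div 2 = k}"
    by (rule card_odd_partitions_hook[OF assms, symmetric])
  finally show "card {\<mu> \<in> distinct_partitions n. hd \<mu> = k} =
    card {\<nu> \<in> odd_partitions n. length \<nu> + hd \<nu> div 2 = k}" .
qed

text \<open>
  Since \<open>hd \<nu>\<close> is odd, the rank of \<open>\<mu>\<close> is \<open>hd \<nu> - 1\<close> when it is even and \<open>hd \<nu>\<close> when it is odd: the
  parity term measures the difference between the rank and \<open>hd \<nu> - 1\<close>.
\<close>
lemma length_plus_rank_parity_iterated_dyson:
  assumes "odd_partition \<nu>" "\<nu> \<noteq> []"
  defines "\<mu> \<equiv> iterated_dyson \<nu>"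
  shows "real (length \<mu>) + (1 - (-1) powi rank \<mu>) / 2 = real (hd \<mu>) - (real (hd \<nu>) - 1)"
proof -
  have hd: "real (hd \<mu>) = real_of_int (rank \<mu>) + real (length \<mu>)"
    by (simp add: rank_def largest_part_def)
  have "odd (hd \<nu>)" using assms by (simp add: odd_partition_def)
  moreover have "rank \<mu> \<in> {int (hd \<nu>) - 1, int (hd \<nu>)}"
    using iterated_dyson_props[OF assms(1)] assms(2) by (simp add: \<mu>_def)
  ultimately consider "rank \<mu> = int (hd \<nu>) - 1" "even (rank \<mu>)" | "rank \<mu> = int (hd \<nu>)" "odd (rank \<mu>)"
    by auto
  then show ?thesis
    by cases (simp_all add: hd power_int_minus_left)
qed

theorem theorem2p4:
  fixes n :: nat
  assumes "n > 0"
  shows "(\<Sum>\<mu>\<in>distinct_partitions n. real (length \<mu>) + (1 - (-1) powi rank \<mu>) / 2)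
       = (\<Sum>\<nu>\<in>odd_partitions n. real (length \<nu>) - (real (largest_part \<nu>) - 1) / 2)"
proof -
  let ?O = "odd_partitions n"
  have odd: "odd_partition \<nu>" "\<nu> \<noteq> []" if "\<nu> \<in> ?O" for \<nu>
    using that assms by (auto simp: odd_partitions_eq)
  have half: "real (hd \<nu> div 2) = (real (hd \<nu>) - 1) / 2" if "\<nu> \<in> ?O" for \<nu>
  proof -
    have "odd (hd \<nu>)" using odd[OF that] by (simp add: odd_partition_def)
    then show ?thesis by (auto elim!: oddE)
  qed
  have "(\<Sum>\<mu>\<in>distinct_partitions n. real (length \<mu>) + (1 - (-1) powi rank \<mu>) / 2) =
    (\<Sum>\<nu>\<in>?O. real (length (iterated_dyson \<nu>)) + (1 - (-1) powi rank (iterated_dyson \<nu>)) / 2)"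
    by (rule sum.reindex_bij_betw[OF bij_betw_iterated_dyson, symmetric])
  also have "\<dots> = (\<Sum>\<nu>\<in>?O. real (hd (iterated_dyson \<nu>)) - (real (hd \<nu>) - 1))"
    using odd by (intro sum.cong refl length_plus_rank_parity_iterated_dyson)
  also have "\<dots> = (\<Sum>\<nu>\<in>?O. real (hd (iterated_dyson \<nu>))) - (\<Sum>\<nu>\<in>?O. real (hd \<nu>) - 1)"
    by (rule sum_subtractf)
  also have "(\<Sum>\<nu>\<in>?O. real (hd (iterated_dyson \<nu>))) = (\<Sum>\<mu>\<in>distinct_partitions n. real (hd \<mu>))"
    by (rule sum.reindex_bij_betw[OF bij_betw_iterated_dyson])
  also have "\<dots> = (\<Sum>\<nu>\<in>?O. real (length \<nu> + hd \<nu> div 2))"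
    using sum_largest_part_eq_sum_hook[OF assms] by (simp only: of_nat_sum[symmetric])
  also have "\<dots> - (\<Sum>\<nu>\<in>?O. real (hd \<nu>) - 1) =
    (\<Sum>\<nu>\<in>?O. real (length \<nu> + hd \<nu> div 2) - (real (hd \<nu>) - 1))"
    by (rule sum_subtractf[symmetric])
  also have "\<dots> = (\<Sum>\<nu>\<in>?O. real (length \<nu>) - (real (largest_part \<nu>) - 1) / 2)"
  proof (rule sum.cong[OF refl])
    fix \<nu> assume "\<nu> \<in> ?O"
    show "real (length \<nu> + hd \<nu> div 2) - (real (hd \<nu>) - 1) =
      real (length \<nu>) - (real (largest_part \<nu>) - 1) / 2"
      unfolding of_nat_add half[OF \<open>\<nu> \<in> ?O\<close>] largest_part_def by (simp add: field_simps)
  qed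
  finally show ?thesis .
qed

end
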